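(* For a completely regular frame $L$, the following are equivalent: (1) $L$ is perfectly regular. (2) $\mathfrak{c}(a)=\bigvee\{\mathfrak{c}(b)\mid b\in\mathrm{Coz}\,L,\ a\le b\}$ for each $a\in L$, where $\bigvee$ is the join in the coframe $\mathsf{S}L$ of all sublocales of $L$. (3) $\mathfrak{c}(a)=\bigsqcup\{\mathfrak{c}(b)\mid b\in\mathrm{Coz}\,L,\ a\le b\}$ for each $a\in L$, where $\bigsqcup$ is the join in the poset $\mathfrak{c}(L)$ of closed sublocales of $L$. (4) $\mathfrak{o}(a)=\mathop{\sqcap}\{\mathfrak{o}(b)\mid b\in\mathrm{Coz}\,L,\ a\le b\}$ for each $a\in L$, where $\mathop{\sqcap}$ is the meet in the poset $\mathfrak{o}(L)$ of open sublocales of $L$.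
   Context: An element $a$ of a frame $L$ is a cozero element if $a=h(\mathbb{R}\setminus\{0\})$ for some frame homomorphism $h:\mathfrak{O}\mathbb{R}\to L$; $\mathrm{Coz}\,L$ is the set of cozero elements of $L$. A frame $L$ is completely regular iff every element of $L$ is a join of cozero elements; it is perfectly regular if every element is a join of cozero elements and every element is a meet of cozero elements. A sublocale of $L$ is a subset $S\subseteq L$ closed under arbitrary meets such that $x\to s\in S$ for all $x\in L$, $s\in S$, where $\to$ is the Heyting implication of $L$. $\mathsf{S}L$ is the set of all sublocales of $L$ ordered by inclusion; it is a coframe in which meets are intersections and joins are $\bigvee_i S_i=\{\bigwedge A\mid A\subseteq\bigcup_i S_i\}$. For $a\in L$, the open and closed sublocales are $\mathfrak{o}(a)=\{a\to x\mid x\in L\}$ and $\mathfrak{c}(a)=\{x\in L\mid x\ge a\}$. Put $\mathfrak{o}(L)=\{\mathfrak{o}(a)\mid a\in L\}$ and $\mathfrak{c}(L)=\{\mathfrak{c}(a)\mid a\in L\}$, ordered by inclusion. In $\mathfrak{c}(L)$, $\bigsqcup_i\mathfrak{c}(a_i)$ is the smallest closed sublocale containing $\bigvee_i\mathfrak{c}(a_i)$; in $\mathfrak{o}(L)$, $\mathop{\sqcap}_i\mathfrak{o}(a_i)$ is the largest open sublocale contained in $\bigcap_i\mathfrak{o}(a_i)$. *)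

theory Defs
  imports "HOL-Analysis.Elementary_Topology"
begin

section \<open>Frames\<close>

class frame = complete_lattice +
  assumes inf_Sup_frame: "inf a (Sup B) = (SUP b\<in>B. inf a b)"

definition frame_hom :: "('a::frame \<Rightarrow> 'b::frame) \<Rightarrow> bool" where
  "frame_hom h \<longleftrightarrow>
     h top = top \<and>
     (\<forall>x y. h (inf x y) = inf (h x) (h y)) \<and>
     (\<forall>A. h (Sup A) = (SUP x\<in>A. h x))"

definition himp :: "'a::frame \<Rightarrow> 'a \<Rightarrow> 'a"  (infixr \<open>\<^bold>\<rightarrow>\<close> 60) where
  "a \<^bold>\<rightarrow> b = Sup {x. inf x a \<le> b}"

lemma le_himp_iff: "c \<le> a \<^bold>\<rightarrow> b \<longleftrightarrow> inf c a \<le> b" for a b c :: "'a::frame"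
proof
  assume "c \<le> a \<^bold>\<rightarrow> b"
  then have "inf c a \<le> inf a (a \<^bold>\<rightarrow> b)"
    by (simp add: le_infI1)
  also have "\<dots> = (SUP x\<in>{x. inf x a \<le> b}. inf a x)"
    by (simp add: himp_def inf_Sup_frame)
  also have "\<dots> \<le> b"
    by (auto intro!: SUP_least simp: inf.commute)
  finally show "inf c a \<le> b" .
qed (auto simp: himp_def intro: Sup_upper)

section \<open>The frame of open sets of a topological space\<close>

typedef (overloaded) 'a opens = "{U::'a::topological_space set. open U}"
  morphisms points_of Opens
  by blast

setup_lifting type_definition_opens

instantiation opens :: (topological_space) frame
begin

lift_definition less_eq_opens :: "'a opens \<Rightarrow> 'a opens \<Rightarrow> bool" is "(\<subseteq>)" .
lift_definition less_opens :: "'a opens \<Rightarrow> 'a opens \<Rightarrow> bool" is "(\<subset>)" .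
lift_definition inf_opens :: "'a opens \<Rightarrow> 'a opens \<Rightarrow> 'a opens" is "(\<inter>)" by (rule open_Int)
lift_definition sup_opens :: "'a opens \<Rightarrow> 'a opens \<Rightarrow> 'a opens" is "(\<union>)" by (rule open_Un)
lift_definition bot_opens :: "'a opens" is "{}" by (rule open_empty)
lift_definition top_opens :: "'a opens" is "UNIV" by (rule open_UNIV)
lift_definition Sup_opens :: "'a opens set \<Rightarrow> 'a opens" is "\<lambda>\<U>. \<Union>\<U>" by blast
lift_definition Inf_opens :: "'a opens set \<Rightarrow> 'a opens" is "\<lambda>\<U>. interior (\<Inter>\<U>)"
  by (rule open_interior)

instance
proof
  fix x y z :: "'a opens" and A :: "'a opens set"
  show "x < y \<longleftrightarrow> x \<le> y \<and> \<not> y \<le> x" by transfer blast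
  show "x \<le> x" by transfer blast
  show "x \<le> y \<Longrightarrow> y \<le> z \<Longrightarrow> x \<le> z" by transfer blast
  show "x \<le> y \<Longrightarrow> y \<le> x \<Longrightarrow> x = y" by transfer blast
  show "inf x y \<le> x" by transfer blast
  show "inf x y \<le> y" by transfer blast
  show "x \<le> y \<Longrightarrow> x \<le> z \<Longrightarrow> x \<le> inf y z" by transfer blast
  show "x \<le> sup x y" by transfer blast
  show "y \<le> sup x y" by transfer blast
  show "y \<le> x \<Longrightarrow> z \<le> x \<Longrightarrow> sup y z \<le> x" by transfer blast
  show "x \<in> A \<Longrightarrow> Inf A \<le> x"
    by transfer (rule order_trans[OF interior_subset Inter_lower])
  show "(\<And>x. x \<in> A \<Longrightarrow> z \<le> x) \<Longrightarrow> z \<le> Inf A"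
    by transfer (simp add: interior_maximal Inter_greatest)
  show "x \<in> A \<Longrightarrow> x \<le> Sup A" by transfer blast
  show "(\<And>x. x \<in> A \<Longrightarrow> x \<le> z) \<Longrightarrow> Sup A \<le> z" by transfer blast
  show "Inf {} = (top :: 'a opens)" by transfer simp
  show "Sup {} = (bot :: 'a opens)" by transfer simp
  show "inf x (Sup A) = (SUP y\<in>A. inf x y)" by transfer blast
qed

end

section \<open>Cozero elements, complete and perfect regularity\<close>

definition Coz :: "'a::frame set" where
  "Coz = {a. \<exists>h :: real opens \<Rightarrow> 'a. frame_hom h \<and> a = h (Opens (UNIV - {0}))}"

text \<open>The type argument stands for the frame itself: the predicates below say that the type
  of the elements, with its class operations, is completely or perfectly regular.\<close>

definition completely_regular :: "'a::frame itself \<Rightarrow> bool" where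
  "completely_regular _ \<longleftrightarrow> (\<forall>a::'a. \<exists>B\<subseteq>Coz. a = Sup B)"

definition perfectly_regular :: "'a::frame itself \<Rightarrow> bool" where
  "perfectly_regular _ \<longleftrightarrow>
     (\<forall>a::'a. \<exists>B\<subseteq>Coz. a = Sup B) \<and> (\<forall>a::'a. \<exists>B\<subseteq>Coz. a = Inf B)"

section \<open>Sublocales\<close>

definition sublocales :: "'a::frame set set" where
  "sublocales = {S. (\<forall>A\<subseteq>S. Inf A \<in> S) \<and> (\<forall>x. \<forall>s\<in>S. x \<^bold>\<rightarrow> s \<in> S)}"

definition sublocale_Sup :: "'a::frame set set \<Rightarrow> 'a set" where
  "sublocale_Sup \<S> = {Inf A |A. A \<subseteq> \<Union>\<S>}"

definition open_sl :: "'a::frame \<Rightarrow> 'a set" where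
  "open_sl a = {a \<^bold>\<rightarrow> x |x. True}"

definition closed_sl :: "'a::frame \<Rightarrow> 'a set" where
  "closed_sl a = {x. a \<le> x}"

definition open_sublocales :: "'a::frame set set" where
  "open_sublocales = range open_sl"

definition closed_sublocales :: "'a::frame set set" where
  "closed_sublocales = range closed_sl"

definition closed_Sup :: "'a::frame set set \<Rightarrow> 'a set" where
  "closed_Sup \<C> = (LEAST C. C \<in> closed_sublocales \<and> sublocale_Sup \<C> \<subseteq> C)"

definition open_Inf :: "'a::frame set set \<Rightarrow> 'a set" where
  "open_Inf \<O> = (GREATEST U. U \<in> open_sublocales \<and> U \<subseteq> \<Inter>\<O>)"

subsection \<open>Basic facts: the lattice operations above are well defined\<close>

lemma himp_Inf: "x \<^bold>\<rightarrow> Inf A = (INF a\<in>A. x \<^bold>\<rightarrow> a)" for x :: "'a::frame"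
proof -
  have "c \<le> x \<^bold>\<rightarrow> Inf A \<longleftrightarrow> c \<le> (INF a\<in>A. x \<^bold>\<rightarrow> a)" for c
    by (simp add: le_INF_iff le_himp_iff le_Inf_iff)
  then show ?thesis by (meson order.antisym order_refl)
qed

lemma himp_himp: "x \<^bold>\<rightarrow> (y \<^bold>\<rightarrow> z) = inf x y \<^bold>\<rightarrow> z" for x :: "'a::frame"
proof -
  have "c \<le> x \<^bold>\<rightarrow> (y \<^bold>\<rightarrow> z) \<longleftrightarrow> c \<le> inf x y \<^bold>\<rightarrow> z" for c
    by (simp add: le_himp_iff inf.assoc)
  then show ?thesis by (meson order.antisym order_refl)
qed

lemma closed_sublocales_subset: "closed_sublocales \<subseteq> sublocales"
  by (auto simp: closed_sublocales_def sublocales_def closed_sl_def le_himp_iff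
      intro: Inf_greatest le_infI1)

lemma open_sublocales_subset: "open_sublocales \<subseteq> (sublocales :: 'a::frame set set)"
proof
  fix S :: "'a set" assume "S \<in> open_sublocales"
  then obtain a where S: "S = open_sl a" by (auto simp: open_sublocales_def)
  have "Inf A \<in> S" if "A \<subseteq> S" for A
  proof -
    have "x = a \<^bold>\<rightarrow> x" if "x \<in> A" for x
      using that \<open>A \<subseteq> S\<close> by (auto simp: S open_sl_def himp_himp)
    then have "(INF x\<in>A. a \<^bold>\<rightarrow> x) = Inf A" by simp
    then have "Inf A = a \<^bold>\<rightarrow> Inf A" by (simp only: himp_Inf)
    then show ?thesis by (auto simp: S open_sl_def)
  qed
  moreover have "x \<^bold>\<rightarrow> s \<in> S" if "s \<in> S" for x s
  proof -
    from that obtain y where "s = a \<^bold>\<rightarrow> y" by (auto simp: S open_sl_def)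
    then have "x \<^bold>\<rightarrow> s = a \<^bold>\<rightarrow> (x \<^bold>\<rightarrow> y)" by (simp add: himp_himp inf.commute)
    then show ?thesis by (auto simp: S open_sl_def)
  qed
  ultimately show "S \<in> sublocales" by (simp add: sublocales_def)
qed

lemma sublocale_Sup_in_sublocales:
  assumes "\<S> \<subseteq> sublocales"
  shows "sublocale_Sup \<S> \<in> sublocales"
proof -
  have "Inf B \<in> sublocale_Sup \<S>" if "B \<subseteq> sublocale_Sup \<S>" for B
  proof -
    have "\<forall>b\<in>B. \<exists>A. A \<subseteq> \<Union>\<S> \<and> b = Inf A"
      using that by (auto simp: sublocale_Sup_def)
    then obtain f where f: "\<And>b. b \<in> B \<Longrightarrow> f b \<subseteq> \<Union>\<S> \<and> b = Inf (f b)" by metis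
    have "Inf B = Inf (\<Union>(f ` B))"
    proof -
      have "c \<le> Inf B \<longleftrightarrow> c \<le> Inf (\<Union>(f ` B))" for c
      proof -
        have "c \<le> b \<longleftrightarrow> (\<forall>x\<in>f b. c \<le> x)" if "b \<in> B" for b
          using f[OF that] le_Inf_iff[of c "f b"] by simp
        then show ?thesis by (simp add: le_Inf_iff)
      qed
      then show ?thesis by (meson order.antisym order_refl)
    qed
    moreover have "\<Union>(f ` B) \<subseteq> \<Union>\<S>" using f by blast
    ultimately show ?thesis unfolding sublocale_Sup_def by blast
  qed
  moreover have "x \<^bold>\<rightarrow> s \<in> sublocale_Sup \<S>" if "s \<in> sublocale_Sup \<S>" for x s
  proof -
    from that obtain A where A: "A \<subseteq> \<Union>\<S>" "s = Inf A" by (auto simp: sublocale_Sup_def)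
    have "(\<lambda>a. x \<^bold>\<rightarrow> a) ` A \<subseteq> \<Union>\<S>"
    proof
      fix y assume "y \<in> (\<lambda>a. x \<^bold>\<rightarrow> a) ` A"
      then obtain a where a: "a \<in> A" "y = x \<^bold>\<rightarrow> a" by blast
      then obtain S where S: "S \<in> \<S>" "a \<in> S" using A(1) by blast
      then have "y \<in> S" using assms a(2) by (simp add: sublocales_def subset_iff)
      then show "y \<in> \<Union>\<S>" using S(1) by blast
    qed
    then show ?thesis
      unfolding sublocale_Sup_def A(2) himp_Inf by (intro CollectI exI conjI) (rule refl)
  qed
  ultimately show ?thesis by (simp add: sublocales_def)
qed

lemma sublocale_Sup_upper: "S \<in> \<S> \<Longrightarrow> S \<subseteq> sublocale_Sup \<S>"
proof
  fix x assume "S \<in> \<S>" "x \<in> S"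
  then show "x \<in> sublocale_Sup \<S>"
    unfolding sublocale_Sup_def by (intro CollectI exI[of _ "{x}"]) auto
qed

lemma sublocale_Sup_least:
  assumes "T \<in> sublocales" "\<And>S. S \<in> \<S> \<Longrightarrow> S \<subseteq> T"
  shows "sublocale_Sup \<S> \<subseteq> T"
proof
  fix x assume "x \<in> sublocale_Sup \<S>"
  then obtain A where A: "A \<subseteq> \<Union>\<S>" "x = Inf A" by (auto simp: sublocale_Sup_def)
  moreover have "A \<subseteq> T" using A(1) assms(2) by (meson Sup_least order_trans)
  ultimately show "x \<in> T" using assms(1) by (simp add: sublocales_def)
qed

lemma closed_sl_subset_iff: "closed_sl a \<subseteq> closed_sl b \<longleftrightarrow> b \<le> a"
  by (auto simp: closed_sl_def)

lemma open_sl_subset_iff: "open_sl a \<subseteq> open_sl b \<longleftrightarrow> a \<le> b" for a b :: "'a::frame"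
proof
  assume "a \<le> b"
  then show "open_sl a \<subseteq> open_sl b"
  proof -
    have "a \<^bold>\<rightarrow> x = b \<^bold>\<rightarrow> (a \<^bold>\<rightarrow> x)" for x
      using \<open>a \<le> b\<close> by (simp add: himp_himp inf.absorb2)
    then show ?thesis by (auto simp: open_sl_def)
  qed
next
  assume "open_sl a \<subseteq> open_sl b"
  then obtain x where x: "a \<^bold>\<rightarrow> b = b \<^bold>\<rightarrow> x" by (auto simp: open_sl_def)
  then have "b \<^bold>\<rightarrow> (a \<^bold>\<rightarrow> b) = a \<^bold>\<rightarrow> b" by (simp add: himp_himp)
  moreover have "b \<^bold>\<rightarrow> (a \<^bold>\<rightarrow> b) = top"
    by (simp add: top_unique [symmetric] le_himp_iff)
  ultimately show "a \<le> b"
    by (metis inf_top_left le_himp_iff order_refl)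
qed

lemma ex_least_closed:
  fixes A :: "'a::frame set"
  defines "P \<equiv> \<lambda>C. C \<in> closed_sublocales \<and> sublocale_Sup (closed_sl ` A) \<subseteq> C"
  shows "\<exists>C. P C \<and> (\<forall>D. P D \<longrightarrow> C \<subseteq> D)"
proof (intro exI conjI allI impI)
  have "sublocale_Sup (closed_sl ` A) \<subseteq> closed_sl (Inf A)"
  proof (rule sublocale_Sup_least)
    show "closed_sl (Inf A) \<in> sublocales"
      using closed_sublocales_subset unfolding closed_sublocales_def by blast
    show "S \<subseteq> closed_sl (Inf A)" if "S \<in> closed_sl ` A" for S
    proof -
      from that obtain a where "a \<in> A" "S = closed_sl a" by blast
      then show ?thesis by (simp add: closed_sl_subset_iff Inf_lower)
    qed
  qed
  then show "P (closed_sl (Inf A))" by (simp add: P_def closed_sublocales_def)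
  fix D assume "P D"
  then obtain d where d: "D = closed_sl d" "sublocale_Sup (closed_sl ` A) \<subseteq> closed_sl d"
    by (auto simp: P_def closed_sublocales_def)
  have "closed_sl a \<subseteq> closed_sl d" if "a \<in> A" for a
    using sublocale_Sup_upper[OF imageI[OF that]] d(2) by (rule subset_trans)
  then show "closed_sl (Inf A) \<subseteq> D"
    by (auto simp: d(1) closed_sl_subset_iff intro: Inf_greatest)
qed

lemma ex_greatest_open:
  fixes A :: "'a::frame set"
  defines "P \<equiv> \<lambda>U. U \<in> open_sublocales \<and> U \<subseteq> \<Inter>(open_sl ` A)"
  shows "\<exists>U. P U \<and> (\<forall>V. P V \<longrightarrow> V \<subseteq> U)"
proof (intro exI conjI allI impI)
  have "open_sl (Inf A) \<subseteq> open_sl a" if "a \<in> A" for a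
    using that by (simp add: open_sl_subset_iff Inf_lower)
  then show "P (open_sl (Inf A))" by (auto simp: P_def open_sublocales_def)
  fix V assume "P V"
  then obtain v where v: "V = open_sl v" "\<And>a. a \<in> A \<Longrightarrow> open_sl v \<subseteq> open_sl a"
    by (auto simp: P_def open_sublocales_def le_INF_iff)
  then show "V \<subseteq> open_sl (Inf A)"
    by (auto simp: v(1) open_sl_subset_iff intro: Inf_greatest)
qed

end

theory Submission
  imports Defs
begin

text \<open>The smallest closed sublocale containing every \<open>\<cc>(b)\<close>, \<open>b \<in> B\<close>, is \<open>\<cc>(\<Sqinter>B)\<close>, and
  the largest open sublocale contained in every \<open>\<oo>(b)\<close> is \<open>\<oo>(\<Sqinter>B)\<close>. So (3) and (4) both say
  that each \<open>a\<close> is the meet of the cozero elements above it. For (2), an element \<open>x \<ge> a\<close> is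
  the meet of the cozero elements \<open>b \<ge> x\<close>, each of which lies in its own \<open>\<cc>(b)\<close>; conversely,
  \<open>a\<close> itself is a meet of elements lying above cozero elements that lie above \<open>a\<close>.\<close>

lemma closed_sl_in_sublocales: "closed_sl a \<in> sublocales"
  using closed_sublocales_subset by (auto simp: closed_sublocales_def)

text \<open>\<open>closed_sl c\<close> is a sublocale, so it contains the join as soon as it
  contains each \<open>closed_sl b\<close>, which amounts to \<open>c \<le> b\<close>.\<close>

lemma sublocale_Sup_closed_subset_iff:
  "sublocale_Sup (closed_sl ` B) \<subseteq> closed_sl c \<longleftrightarrow> c \<le> Inf B" for c :: "'a::frame"
proof
  assume *: "sublocale_Sup (closed_sl ` B) \<subseteq> closed_sl c"
  have "closed_sl b \<subseteq> closed_sl c" if "b \<in> B" for b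
    using sublocale_Sup_upper[OF imageI[OF that]] * by (rule subset_trans)
  then show "c \<le> Inf B"
    by (simp add: closed_sl_subset_iff le_Inf_iff)
next
  assume "c \<le> Inf B"
  then have "S \<subseteq> closed_sl c" if "S \<in> closed_sl ` B" for S
    using that by (metis closed_sl_subset_iff imageE le_Inf_iff)
  then show "sublocale_Sup (closed_sl ` B) \<subseteq> closed_sl c"
    by (rule sublocale_Sup_least[OF closed_sl_in_sublocales])
qed

lemma closed_Sup_eq: "closed_Sup (closed_sl ` B) = closed_sl (Inf B)" for B :: "'a::frame set"
  unfolding closed_Sup_def
proof (rule Least_equality)
  show "closed_sl (Inf B) \<in> closed_sublocales \<and>
      sublocale_Sup (closed_sl ` B) \<subseteq> closed_sl (Inf B)"
    by (simp add: closed_sublocales_def sublocale_Sup_closed_subset_iff)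
next
  fix C assume "C \<in> closed_sublocales \<and> sublocale_Sup (closed_sl ` B) \<subseteq> C"
  then show "closed_sl (Inf B) \<subseteq> C"
    by (metis closed_sublocales_def rangeE sublocale_Sup_closed_subset_iff closed_sl_subset_iff)
qed

text \<open>\<open>open_sl\<close> is an order embedding, so the open sublocales inside the
  intersection are exactly the \<open>open_sl c\<close> with \<open>c\<close> a lower bound of
  \<open>B\<close>.\<close>

lemma open_Inf_eq: "open_Inf (open_sl ` B) = open_sl (Inf B)" for B :: "'a::frame set"
proof -
  have below: "open_sl c \<subseteq> \<Inter>(open_sl ` B) \<longleftrightarrow> c \<le> Inf B" for c
    by (simp add: le_INF_iff le_Inf_iff open_sl_subset_iff)
  show ?thesis
    unfolding open_Inf_def
  proof (rule Greatest_equality)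
    show "open_sl (Inf B) \<in> open_sublocales \<and> open_sl (Inf B) \<subseteq> \<Inter>(open_sl ` B)"
      by (simp only: open_sublocales_def below) simp
  next
    fix U assume "U \<in> open_sublocales \<and> U \<subseteq> \<Inter>(open_sl ` B)"
    then show "U \<subseteq> open_sl (Inf B)"
      by (metis open_sublocales_def rangeE below open_sl_subset_iff)
  qed
qed

lemma closed_sl_inject: "closed_sl a = closed_sl b \<longleftrightarrow> a = b"
  by (metis closed_sl_subset_iff order.antisym order_refl)

lemma open_sl_inject: "open_sl a = open_sl b \<longleftrightarrow> a = b" for a b :: "'a::frame"
  by (metis open_sl_subset_iff order.antisym order_refl)

text \<open>Enlarging a set of cozero elements with meet \<open>a\<close> to all cozero elements
  above \<open>a\<close> can only lower the meet, while \<open>a\<close> remains a lower bound.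
  Complete regularity supplies the half about joins.\<close>

lemma perfectly_regular_iff:
  assumes "completely_regular TYPE('a::frame)"
  shows "perfectly_regular TYPE('a) \<longleftrightarrow> (\<forall>a::'a. a = Inf {b \<in> Coz. a \<le> b})"
proof -
  have "(\<exists>B\<subseteq>Coz. a = Inf B) \<longleftrightarrow> a = Inf {b \<in> Coz. a \<le> b}" for a :: 'a
  proof
    assume "\<exists>B\<subseteq>Coz. a = Inf B"
    then obtain B where B: "B \<subseteq> Coz" "a = Inf B" by blast
    then have "B \<subseteq> {b \<in> Coz. a \<le> b}" by (auto intro: Inf_lower)
    then have "Inf {b \<in> Coz. a \<le> b} \<le> a" unfolding B(2) by (rule Inf_superset_mono)
    then show "a = Inf {b \<in> Coz. a \<le> b}" by (intro order.antisym Inf_greatest) auto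
  next
    assume "a = Inf {b \<in> Coz. a \<le> b}"
    then show "\<exists>B\<subseteq>Coz. a = Inf B" by (intro exI[of _ "{b \<in> Coz. a \<le> b}"] conjI) auto
  qed
  then show ?thesis
    using assms by (simp only: perfectly_regular_def completely_regular_def simp_thms)
qed

text \<open>The quantifier over \<open>a\<close> stays on both sides because the backward direction
  at \<open>a\<close> uses the meet formula at every \<open>x \<ge> a\<close>.\<close>

lemma closed_sl_eq_sublocale_Sup_iff:
  fixes D :: "'a::frame set"
  shows "(\<forall>a. closed_sl a = sublocale_Sup (closed_sl ` {b \<in> D. a \<le> b})) \<longleftrightarrow>
    (\<forall>a. a = Inf {b \<in> D. a \<le> b})" (is "?L \<longleftrightarrow> ?R")
proof
  assume L: ?L
  show ?R
  proof
    fix a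
    have "closed_sl a = sublocale_Sup (closed_sl ` {b \<in> D. a \<le> b})"
      using L by blast
    then have "a \<in> sublocale_Sup (closed_sl ` {b \<in> D. a \<le> b})"
      by (auto simp: closed_sl_def)
    then obtain A where A: "A \<subseteq> \<Union>(closed_sl ` {b \<in> D. a \<le> b})" "a = Inf A"
      unfolding sublocale_Sup_def by blast
    \<comment> \<open>Each member of \<open>A\<close> lies in some \<open>closed_sl b\<close>, hence
      above that \<open>b\<close>.\<close>
    have "Inf {b \<in> D. a \<le> b} \<le> Inf A"
    proof (rule Inf_mono)
      fix x assume "x \<in> A"
      with A(1) show "\<exists>b\<in>{b \<in> D. a \<le> b}. b \<le> x" by (auto simp: closed_sl_def)
    qed
    then show "a = Inf {b \<in> D. a \<le> b}"
      unfolding A(2)[symmetric] by (intro order.antisym Inf_greatest) auto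
  qed
next
  assume R: ?R
  show ?L
  proof (intro allI subset_antisym subsetI)
    fix a x :: 'a assume "x \<in> closed_sl a"
    \<comment> \<open>From \<open>a \<le> x \<le> b\<close>, the element \<open>b\<close> is among
      those indexing the join, and it belongs to \<open>closed_sl b\<close>.\<close>
    then have "{b \<in> D. x \<le> b} \<subseteq> \<Union>(closed_sl ` {b \<in> D. a \<le> b})"
      by (auto simp: closed_sl_def)
    moreover have "x = Inf {b \<in> D. x \<le> b}" using R by (rule spec)
    ultimately show "x \<in> sublocale_Sup (closed_sl ` {b \<in> D. a \<le> b})"
      unfolding sublocale_Sup_def by (intro CollectI exI conjI)
  next
    fix a x :: 'a assume "x \<in> sublocale_Sup (closed_sl ` {b \<in> D. a \<le> b})"
    moreover have "sublocale_Sup (closed_sl ` {b \<in> D. a \<le> b}) \<subseteq> closed_sl a"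
      unfolding sublocale_Sup_closed_subset_iff by (auto intro: Inf_greatest)
    ultimately show "x \<in> closed_sl a" by blast
  qed
qed

theorem corollary4p2:
  assumes "completely_regular TYPE('a::frame)"
  shows "(perfectly_regular TYPE('a) \<longleftrightarrow>
            (\<forall>a::'a. closed_sl a = sublocale_Sup {closed_sl b |b. b \<in> Coz \<and> a \<le> b}))
       \<and> (perfectly_regular TYPE('a) \<longleftrightarrow>
            (\<forall>a::'a. closed_sl a = closed_Sup {closed_sl b |b. b \<in> Coz \<and> a \<le> b}))
       \<and> (perfectly_regular TYPE('a) \<longleftrightarrow>
            (\<forall>a::'a. open_sl a = open_Inf {open_sl b |b. b \<in> Coz \<and> a \<le> b}))"
proof -
  have image: "{f b |b. b \<in> Coz \<and> a \<le> b} = f ` {b \<in> Coz. a \<le> b}"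
    for f :: "'a \<Rightarrow> 'a set" and a
    by blast
  show ?thesis
    \<comment> \<open>All four conditions rewrite to the same meet formula, leaving reflexive
      equivalences.\<close>
    unfolding image closed_Sup_eq open_Inf_eq closed_sl_inject open_sl_inject
      closed_sl_eq_sublocale_Sup_iff perfectly_regular_iff[OF assms]
    by (intro conjI refl)
qed

end
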